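(* For $a=(a_k)\in\omega$ and $n,k\in\mathbb N_0$ with $k\le n$ put $$\bar a_k(n)=\lambda_k\left\{\frac{a_kf_{k+1}^2}{(\lambda_k-\lambda_{k-1})f_kf_{k+1}}+\left[\frac1{(\lambda_k-\lambda_{k-1})f_kf_{k+1}}-\frac1{(\lambda_{k+1}-\lambda_k)f_{k+1}f_{k+2}}\right]\sum_{j=k+1}^nf_{j+1}^2a_j\right\},$$ (empty sum $=0$ when $k=n$), $\bar a_k(n)=0$ for $k>n$, and $\bar a_k=\lim_{n\to\infty}\bar a_k(n)$ when the limit exists. Let $1<p\le\infty$, with $q=p/(p-1)$ if $p<\infty$ and $q=1$ if $p=\infty$, and define $$d_3=\Big\{a\in\omega:\sum_{j=k+1}^\infty a_jf_{j+1}^2\text{ converges for each }k\in\mathbb N_0\Big\},\qquad d_4=d_4(q)=\Big\{a\in\omega:\sup_{n}\sum_{k=0}^{n-1}|\bar a_k(n)|^q<\infty\Big\},$$ $$d_5=\Big\{a\in\omega:\sup_n\Big|\frac{\lambda_nf_{n+1}^2}{(\lambda_n-\lambda_{n-1})f_nf_{n+1}}a_n\Big|<\infty\Big\},\qquad d_6=\Big\{a\in\omega:\sup_{n,k}|\bar a_k(n)|<\infty\Big\},$$ $$d_7=\Big\{a\in\omega:\bar a_k\text{ exists for all }k\text{ and }\lim_{n\to\infty}\sum_k|\bar a_k(n)-\bar a_k|=0\Big\},\qquad d_8=\Big\{a\in\omega:\sup_n\sum_k|\bar a_k(n)|<\infty\Big\}.$$ Then $[\ell_p^{\lambda}(\widehat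 F)]^\beta=d_3\cap d_4\cap d_5$ for $1<p<\infty$, $[\ell_1^{\lambda}(\widehat F)]^\beta=d_3\cap d_5\cap d_6$, and $[\ell_\infty^{\lambda}(\widehat F)]^\beta=d_4\cap d_7\cap d_8$ (with $d_4$ taken for $q=1$).
   Context: $\mathbb N_0=\{0,1,2,\dots\}$; sums without limits run from $0$ to $\infty$; suprema over $n,k$ are over $\mathbb N_0$; $\omega$ is the space of all real sequences $x=(x_k)_{k\in\mathbb N_0}$. Fibonacci numbers: $f_0=f_1=1$, $f_n=f_{n-1}+f_{n-2}$ for $n\ge 2$. $\lambda=(\lambda_k)_{k\in\mathbb N_0}$ is a fixed strictly increasing sequence of positive reals with $\lambda_k\to\infty$. Terms with negative subscript are $0$ (so $\lambda_{-1}=0$, $x_{-1}=0$). For $x\in\omega$ put $$E_n(x)=\frac1{\lambda_n}\sum_{k=0}^n(\lambda_k-\lambda_{k-1})\Big(\frac{f_k}{f_{k+1}}x_k-\frac{f_{k+1}}{f_k}x_{k-1}\Big),\qquad Ex=(E_n(x))_{n\in\mathbb N_0},$$ and $\ell_p^{\lambda}(\widehat F)=\{x\in\omega: Ex\in\ell_p\}$ for $1\le p\le\infty$. The $\beta$-dual of a sequence space $X$ is $X^\beta=\{a\in\omega:\sum_ka_kx_k\text{ converges for all }x\in X\}$. *)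

theory Defs
  imports "HOL-Analysis.Analysis" "HOL-Number_Theory.Fib"
begin

text \<open>The library's Fibonacci sequence starts at 0; here the numbering starts with
  \<open>f\<^sub>0 = f\<^sub>1 = 1\<close>, hence the shift.\<close>

definition fibr :: "nat \<Rightarrow> real" where
  "fibr n = real (fib (Suc n))"

lemma fibr_0: "fibr 0 = 1" and fibr_1: "fibr 1 = 1"
  and fibr_rec: "n \<ge> 2 \<Longrightarrow> fibr n = fibr (n - 1) + fibr (n - 2)"
proof -
  show "fibr 0 = 1" "fibr 1 = 1"
    by (simp_all add: fibr_def)
  show "fibr n = fibr (n - 1) + fibr (n - 2)" if "n \<ge> 2"
  proof -
    from that obtain m where "n = Suc (Suc m)"
      by (metis Suc_le_D numeral_2_eq_2 Suc_le_mono)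
    then show ?thesis
      by (simp add: fibr_def)
  qed
qed

text \<open>\<open>prev x k\<close> is \<open>x\<^sub>k\<^sub>-\<^sub>1\<close>, with the convention that terms with negative subscript are 0.\<close>

definition prev :: "(nat \<Rightarrow> real) \<Rightarrow> nat \<Rightarrow> real" where
  "prev x k = (if k = 0 then 0 else x (k - 1))"

definition E :: "(nat \<Rightarrow> real) \<Rightarrow> (nat \<Rightarrow> real) \<Rightarrow> nat \<Rightarrow> real" where
  "E lam x n = 1 / lam n *
     (\<Sum>k\<le>n. (lam k - prev lam k) *
        (fibr k / fibr (k+1) * x k - fibr (k+1) / fibr k * prev x k))"

text \<open>The classical sequence spaces, intended for \<open>1 \<le> p \<le> \<infinity>\<close>.\<close>

definition ell :: "ereal \<Rightarrow> (nat \<Rightarrow> real) set" where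
  "ell p = (if p = \<infinity> then {x. bounded (range x)}
            else {x. summable (\<lambda>k. \<bar>x k\<bar> powr real_of_ereal p)})"

definition ell_lam_F :: "(nat \<Rightarrow> real) \<Rightarrow> ereal \<Rightarrow> (nat \<Rightarrow> real) set" where
  "ell_lam_F lam p = {x. E lam x \<in> ell p}"

definition beta_dual :: "(nat \<Rightarrow> real) set \<Rightarrow> (nat \<Rightarrow> real) set" where
  "beta_dual X = {a. \<forall>x\<in>X. summable (\<lambda>k. a k * x k)}"

text \<open>The exponent \<open>q\<close> belonging to \<open>1 < p \<le> \<infinity>\<close>.\<close>

definition conj_exp :: "ereal \<Rightarrow> real" where
  "conj_exp p = (if p = \<infinity> then 1 else real_of_ereal p / (real_of_ereal p - 1))"

text \<open>\<open>abar lam a n k\<close> is the number written \<open>a\<^sub>k(n)\<close> with a bar, and \<open>abar_lim lam a k\<close> is its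
  limit for \<open>n \<rightarrow> \<infinity>\<close>; the latter is only meaningful if that limit exists.\<close>

definition abar :: "(nat \<Rightarrow> real) \<Rightarrow> (nat \<Rightarrow> real) \<Rightarrow> nat \<Rightarrow> nat \<Rightarrow> real" where
  "abar lam a n k =
     (if k \<le> n then
        lam k *
          (a k * (fibr (k+1))\<^sup>2 / ((lam k - prev lam k) * fibr k * fibr (k+1))
           + (1 / ((lam k - prev lam k) * fibr k * fibr (k+1))
              - 1 / ((lam (k+1) - lam k) * fibr (k+1) * fibr (k+2)))
             * (\<Sum>j=k+1..n. (fibr (j+1))\<^sup>2 * a j))
      else 0)"

definition abar_lim :: "(nat \<Rightarrow> real) \<Rightarrow> (nat \<Rightarrow> real) \<Rightarrow> nat \<Rightarrow> real" where
  "abar_lim lam a k = lim (\<lambda>n. abar lam a n k)"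

text \<open>Suprema and infinite sums of nonnegative terms are taken in \<open>[0,\<infinity>]\<close>, so that
  finiteness is a genuine condition.\<close>

definition d3 :: "(nat \<Rightarrow> real) set" where
  "d3 = {a. \<forall>k. summable (\<lambda>i. a (k+1+i) * (fibr (k+1+i+1))\<^sup>2)}"

definition d4 :: "(nat \<Rightarrow> real) \<Rightarrow> real \<Rightarrow> (nat \<Rightarrow> real) set" where
  "d4 lam q = {a. (SUP n. ennreal (\<Sum>k<n. \<bar>abar lam a n k\<bar> powr q)) < \<infinity>}"

definition d5 :: "(nat \<Rightarrow> real) \<Rightarrow> (nat \<Rightarrow> real) set" where
  "d5 lam = {a. (SUP n. ennreal \<bar>lam n * (fibr (n+1))\<^sup>2
                   / ((lam n - prev lam n) * fibr n * fibr (n+1)) * a n\<bar>) < \<infinity>}"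

definition d6 :: "(nat \<Rightarrow> real) \<Rightarrow> (nat \<Rightarrow> real) set" where
  "d6 lam = {a. (SUP n. SUP k. ennreal \<bar>abar lam a n k\<bar>) < \<infinity>}"

definition d7 :: "(nat \<Rightarrow> real) \<Rightarrow> (nat \<Rightarrow> real) set" where
  "d7 lam = {a. (\<forall>k. convergent (\<lambda>n. abar lam a n k)) \<and>
                (\<lambda>n. \<Sum>k. ennreal \<bar>abar lam a n k - abar_lim lam a k\<bar>) \<longlonglongrightarrow> 0}"

definition d8 :: "(nat \<Rightarrow> real) \<Rightarrow> (nat \<Rightarrow> real) set" where
  "d8 lam = {a. (SUP n. \<Sum>k. ennreal \<bar>abar lam a n k\<bar>) < \<infinity>}"

end

theory Submission
  imports Defs
begin

text \<open>
  With \<open>y = E x\<close>, which is a bijection of \<open>\<omega>\<close>, Abel summation gives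
  \<open>\<Sum>\<^sub>k\<^sub>\<le>\<^sub>n a\<^sub>k x\<^sub>k = \<Sum>\<^sub>k\<^sub>\<le>\<^sub>n abar n k \<cdot> y\<^sub>k\<close>.  Hence \<open>a\<close> lies in the \<open>\<beta>\<close>-dual iff the
  triangular matrix \<open>abar\<close> maps \<open>\<ell>\<^sub>p\<close> into the convergent sequences.  Necessity of the row
  conditions is a gliding hump argument (Schur's for \<open>p = \<infinity>\<close>); sufficiency is Young's
  inequality.  Convergence of the columns amounts to \<open>d3\<close>: it could only fail to imply
  \<open>d3\<close> if \<open>(\<lambda>\<^sub>k - \<lambda>\<^sub>k\<^sub>-\<^sub>1) f\<^sub>k f\<^sub>k\<^sub>+\<^sub>1\<close> were constant, which would make \<open>\<lambda>\<close> bounded.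
\<close>

subsection \<open>Gliding humps\<close>

text \<open>The blocks between consecutive values of \<open>s\<close> are disjoint, so the least
  \<open>j\<close> with \<open>k < s (Suc j)\<close> identifies the block of \<open>k\<close>. The
  index serves to glue vectors chosen block by block into one sequence.\<close>

lemma block_index:
  fixes s :: "nat \<Rightarrow> nat"
  assumes "strict_mono s"
  obtains idx where "\<And>i k. s i \<le> k \<Longrightarrow> k < s (Suc i) \<Longrightarrow> idx k = i"
proof
  fix i k assume k: "s i \<le> k" "k < s (Suc i)"
  show "(LEAST j. k < s (Suc j)) = i"
  proof (rule Least_equality)
    fix j assume "k < s (Suc j)"
    with k(1) have "s i < s (Suc j)" by linarith
    then show "i \<le> j" using assms by (simp add: strict_mono_less)
  qed fact
qed

text \<open>For each hump the contribution of the earlier blocks is at most the sum of the column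
  bounds, and the later blocks are invisible because the matrix is triangular.\<close>

lemma gliding_hump:
  fixes A :: "nat \<Rightarrow> nat \<Rightarrow> real" and g :: "real \<Rightarrow> real"
  assumes col: "\<And>n k. \<bar>A n k\<bar> \<le> B k"
    and block: "\<And>m M e. 0 < e \<Longrightarrow> \<exists>n\<ge>m. \<exists>u. (\<forall>k. \<bar>u k\<bar> \<le> 1) \<and>
                  (\<Sum>k=m..n. g (u k)) \<le> e \<and> M \<le> (\<Sum>k=m..n. A n k * u k)"
    and g: "\<And>t. 0 \<le> g t"
  obtains x where "\<And>k. \<bar>x k\<bar> \<le> 1" "summable (\<lambda>k. g (x k))"
    "\<And>M. \<exists>n. M \<le> (\<Sum>k\<le>n. A n k * x k)"
proof -
  \<comment> \<open>Block \<open>i\<close> is \<open>{m..<m'}\<close> with hump \<open>u\<close>,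
    tested in row \<open>m' - 1\<close>, whose sum stops exactly at the end of the block. The part
    \<open>sum B\<close> of the gain pays for the earlier blocks and leaves \<open>i\<close>; the
    bounds \<open>(1/2)^i\<close> keep the total of \<open>g\<close> finite.\<close>
  define R where "R i m u m' \<longleftrightarrow> m < m' \<and> (\<forall>k. \<bar>u k\<bar> \<le> 1) \<and>
      (\<Sum>k=m..<m'. g (u k)) \<le> (1/2)^i \<and>
      (\<Sum>k<m. B k) + real i \<le> (\<Sum>k=m..<m'. A (m' - 1) k * u k)"
    for i m :: nat and u :: "nat \<Rightarrow> real" and m' :: nat
  have ex: "\<exists>u m'. R i m u m'" for i m
  proof -
    obtain n u where "n \<ge> m" "\<forall>k. \<bar>u k\<bar> \<le> 1" "(\<Sum>k=m..n. g (u k)) \<le> (1/2)^i"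
      "(\<Sum>k<m. B k) + real i \<le> (\<Sum>k=m..n. A n k * u k)"
      using block[of "(1/2)^i" m "(\<Sum>k<m. B k) + real i"] by auto
    then have "R i m u (Suc n)"
      by (simp add: R_def atLeastLessThanSuc_atLeastAtMost)
    then show ?thesis by blast
  qed
  have "\<exists>s. \<forall>i. (i = 0 \<longrightarrow> s i = 0) \<and> (\<exists>u. R i (s i) u (s (Suc i)))"
    using ex by (intro dependent_nat_choice) blast+
  then obtain s where s0: "s 0 = 0" and "\<And>i. \<exists>u. R i (s i) u (s (Suc i))"
    by metis
  then obtain u where R: "\<And>i. R i (s i) (u i) (s (Suc i))"
    by metis
  have sm: "strict_mono s"
    using R unfolding R_def by (simp add: strict_mono_Suc_iff)
  obtain idx where idx: "\<And>i k. s i \<le> k \<Longrightarrow> k < s (Suc i) \<Longrightarrow> idx k = i"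
    using block_index[OF sm] by metis
  define x where "x k = u (idx k) k" for k
  have x1: "\<bar>x k\<bar> \<le> 1" for k
    using R unfolding x_def R_def by blast
  have split: "sum h {..<s (Suc i)} = sum h {..<s i} + sum h {s i..<s (Suc i)}"
    for h :: "nat \<Rightarrow> real" and i
  proof -
    have "s i \<le> s (Suc i)" using sm by (simp add: strict_mono_less_eq)
    then show ?thesis
      by (simp add: lessThan_atLeast0 sum.atLeastLessThan_concat)
  qed
  have gsum: "(\<Sum>k<s i. g (x k)) \<le> (\<Sum>j<i. (1/2)^j)" for i
  proof (induction i)
    case (Suc i)
    have "(\<Sum>k=s i..<s (Suc i). g (x k)) = (\<Sum>k=s i..<s (Suc i). g (u i k))"
      by (intro sum.cong) (auto simp: x_def idx)
    also have "\<dots> \<le> (1/2)^i" using R[of i] by (simp add: R_def)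
    finally show ?case using Suc by (simp add: split)
  qed (simp add: s0)
  \<comment> \<open>Because of \<open>n \<le> s n\<close> the first \<open>n\<close> terms lie in
    the first \<open>n\<close> blocks; 2 is the value of the full geometric series.\<close>
  have gbd: "(\<Sum>k<n. g (x k)) \<le> 2" for n
  proof -
    have "(\<Sum>k<n. g (x k)) \<le> (\<Sum>k<s n. g (x k))"
      by (intro sum_mono2) (use sm g strict_mono_imp_increasing[OF sm, of n] in auto)
    also have "\<dots> \<le> (\<Sum>j<n. (1/2)^j)" by (rule gsum)
    also have "\<dots> \<le> 2" by (simp add: geometric_sum)
    finally show ?thesis .
  qed
  show ?thesis
  proof (rule that)
    show "summable (\<lambda>k. g (x k))"
      by (rule summableI_nonneg_bounded[OF g gbd])
    fix M :: real
    obtain i :: nat where i: "M \<le> real i" using real_arch_simple by blast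
    define n where "n = s (Suc i) - 1"
    have n: "{..n} = {..<s (Suc i)}"
      using R[of i] by (auto simp: n_def R_def)
    have "\<bar>\<Sum>k<s i. A n k * x k\<bar> \<le> (\<Sum>k<s i. \<bar>A n k * x k\<bar>)" by (rule sum_abs)
    also have "\<dots> \<le> (\<Sum>k<s i. B k)"
    proof (rule sum_mono)
      fix k
      have "\<bar>A n k * x k\<bar> \<le> \<bar>A n k\<bar>"
        using x1[of k] by (simp add: abs_mult mult_left_le)
      then show "\<bar>A n k * x k\<bar> \<le> B k" using col[of n k] by linarith
    qed
    finally have 1: "\<bar>\<Sum>k<s i. A n k * x k\<bar> \<le> (\<Sum>k<s i. B k)" .
    have "(\<Sum>k=s i..<s (Suc i). A n k * x k) = (\<Sum>k=s i..<s (Suc i). A n k * u i k)"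
      by (intro sum.cong) (auto simp: x_def idx)
    also have "\<dots> \<ge> (\<Sum>k<s i. B k) + real i" using R[of i] by (simp add: R_def n_def)
    finally have "M \<le> (\<Sum>k\<le>n. A n k * x k)"
      using 1 i unfolding n split by linarith
    then show "\<exists>n. M \<le> (\<Sum>k\<le>n. A n k * x k)" ..
  qed (rule x1)
qed

text \<open>If the row norms were not null, rows of norm at least \<open>e\<close> would occur
  arbitrarily late. Null columns push their mass to the right, so one can select rows whose mass
  sits almost entirely in disjoint blocks; a sign vector alternating from block to block then makes
  the transform oscillate.\<close>

lemma schur_matrix:
  fixes B :: "nat \<Rightarrow> nat \<Rightarrow> real"
  assumes row: "\<And>n. summable (\<lambda>k. \<bar>B n k\<bar>)"
    and col: "\<And>k. (\<lambda>n. B n k) \<longlonglongrightarrow> 0"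
    and conv: "\<And>x. (\<And>k. \<bar>x k\<bar> \<le> 1) \<Longrightarrow> convergent (\<lambda>n. \<Sum>k. B n k * x k)"
  shows "(\<lambda>n. \<Sum>k. \<bar>B n k\<bar>) \<longlonglongrightarrow> 0"
proof (rule ccontr)
  define N where "N n = (\<Sum>k. \<bar>B n k\<bar>)" for n
  have N0: "0 \<le> N n" for n
    unfolding N_def by (intro suminf_nonneg row) auto
  assume "\<not> ?thesis"
  then have "\<not> N \<longlonglongrightarrow> 0" by (simp add: N_def[abs_def])
  then obtain e where e: "e > 0" and frq: "\<And>m. \<exists>n\<ge>m. e \<le> N n"
    unfolding LIMSEQ_iff by (metis N0 abs_of_nonneg diff_zero not_less real_norm_def)
  \<comment> \<open>Row \<open>n\<close> carries at most \<open>e / 8\<close> of its norm before the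
    block \<open>{m..<m'}\<close> and at most \<open>e / 8\<close> after it. The condition
    \<open>m \<le> n\<close> makes the selected rows tend to infinity.\<close>
  define R where "R m n m' \<longleftrightarrow> m \<le> n \<and> m < m' \<and> e \<le> N n \<and> (\<Sum>k<m. \<bar>B n k\<bar>) \<le> e / 8 \<and>
      N n - e / 8 \<le> (\<Sum>k<m'. \<bar>B n k\<bar>)" for m n m' :: nat
  have ex: "\<exists>n m'. R m n m'" for m
  proof -
    have "(\<lambda>n. \<Sum>k<m. \<bar>B n k\<bar>) \<longlonglongrightarrow> (\<Sum>k<m. \<bar>0\<bar>)"
      by (intro tendsto_intros col)
    then have "\<forall>\<^sub>F n in sequentially. (\<Sum>k<m. \<bar>B n k\<bar>) < e / 8"
      using e by (intro order_tendstoD) auto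
    then obtain n0 where n0: "\<And>n. n \<ge> n0 \<Longrightarrow> (\<Sum>k<m. \<bar>B n k\<bar>) < e / 8"
      by (auto simp: eventually_sequentially)
    obtain n where n: "n \<ge> max m n0" "e \<le> N n" using frq by blast
    have "(\<lambda>j. \<Sum>k<j. \<bar>B n k\<bar>) \<longlonglongrightarrow> N n"
      unfolding N_def by (rule summable_LIMSEQ[OF row])
    then have "\<forall>\<^sub>F j in sequentially. N n - e / 8 < (\<Sum>k<j. \<bar>B n k\<bar>)"
      using e by (intro order_tendstoD) auto
    moreover have "\<forall>\<^sub>F j in sequentially. m < j" by (rule eventually_gt_at_top)
    ultimately have "\<forall>\<^sub>F j in sequentially. N n - e / 8 < (\<Sum>k<j. \<bar>B n k\<bar>) \<and> m < j"
      by (rule eventually_conj)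
    then obtain j where "N n - e / 8 < (\<Sum>k<j. \<bar>B n k\<bar>)" "m < j"
      by (auto simp: eventually_sequentially)
    then have "R m n j" using n n0[of n] by (auto simp: R_def)
    then show ?thesis by blast
  qed
  have "\<exists>s. \<forall>i::nat. (i = 0 \<longrightarrow> s i = 0) \<and> (\<exists>n. R (s i) n (s (Suc i)))"
    using ex by (intro dependent_nat_choice) blast+
  then obtain s where "s 0 = 0" and "\<And>i. \<exists>n. R (s i) n (s (Suc i))"
    by metis
  then obtain \<nu> where R: "\<And>i. R (s i) (\<nu> i) (s (Suc i))"
    by metis
  have sm: "strict_mono s"
    using R unfolding R_def by (simp add: strict_mono_Suc_iff)
  obtain idx where idx: "\<And>i k. s i \<le> k \<Longrightarrow> k < s (Suc i) \<Longrightarrow> idx k = i"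
    using block_index[OF sm] by metis
  \<comment> \<open>The sign of the selected entry collects the absolute mass of the block; the
    factor \<open>(-1) ^ idx k\<close> produces the oscillation.\<close>
  define x where "x k = (-1) ^ idx k * sgn (B (\<nu> (idx k)) k)" for k
  have x1: "\<bar>x k\<bar> \<le> 1" for k
    by (simp add: x_def abs_mult power_abs abs_sgn_eq)
  have Bx: "\<bar>B n k * x k\<bar> \<le> \<bar>B n k\<bar>" for n k
    using x1[of k] by (simp add: abs_mult mult_left_le)
  have sBx: "summable (\<lambda>k. \<bar>B n k * x k\<bar>)" for n
    by (rule summable_comparison_test'[OF row]) (use Bx in auto)
  define D where "D i = (\<Sum>k. B (\<nu> i) k * x k)" for i
  \<comment> \<open>At least \<open>e - e / 8 - e / 8\<close> of the mass lies on the block, and the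
    two remainders disturb it by at most \<open>e / 4\<close>.\<close>
  have big: "e / 2 \<le> (-1) ^ i * D i" for i
  proof -
    let ?n = "\<nu> i" and ?a = "s i" and ?b = "s (Suc i)"
    have ab: "?a \<le> ?b" using R[of i] by (simp add: R_def)
    have split: "suminf h = sum h {..<?a} + sum h {?a..<?b} + (\<Sum>k. h (k + ?b))"
      if "summable h" for h :: "nat \<Rightarrow> real"
    proof -
      have "sum h {..<?b} = sum h {..<?a} + sum h {?a..<?b}"
        using ab by (simp add: lessThan_atLeast0 sum.atLeastLessThan_concat)
      then show ?thesis using suminf_split_initial_segment[OF that, of ?b] by simp
    qed
    have "(\<Sum>k=?a..<?b. B ?n k * x k) = (\<Sum>k=?a..<?b. (-1) ^ i * \<bar>B ?n k\<bar>)"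
      by (intro sum.cong) (auto simp: x_def idx abs_sgn mult_ac)
    then have mid: "(\<Sum>k=?a..<?b. B ?n k * x k) = (-1) ^ i * (\<Sum>k=?a..<?b. \<bar>B ?n k\<bar>)"
      by (simp add: sum_distrib_left)
    have lo: "\<bar>\<Sum>k<?a. B ?n k * x k\<bar> \<le> (\<Sum>k<?a. \<bar>B ?n k\<bar>)"
      by (rule order_trans[OF sum_abs sum_mono[OF Bx]])
    have "\<bar>\<Sum>k. B ?n (k + ?b) * x (k + ?b)\<bar> \<le> (\<Sum>k. \<bar>B ?n (k + ?b) * x (k + ?b)\<bar>)"
      by (rule summable_rabs) (rule summable_ignore_initial_segment[OF sBx])
    also have "\<dots> \<le> (\<Sum>k. \<bar>B ?n (k + ?b)\<bar>)"
      by (intro suminf_le Bx summable_ignore_initial_segment[OF sBx]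
          summable_ignore_initial_segment[OF row])
    finally have hi: "\<bar>\<Sum>k. B ?n (k + ?b) * x (k + ?b)\<bar> \<le> (\<Sum>k. \<bar>B ?n (k + ?b)\<bar>)" .
    have N: "N ?n = (\<Sum>k<?a. \<bar>B ?n k\<bar>) + (\<Sum>k=?a..<?b. \<bar>B ?n k\<bar>) + (\<Sum>k. \<bar>B ?n (k + ?b)\<bar>)"
      unfolding N_def by (rule split[OF row])
    have N': "N ?n = (\<Sum>k<?b. \<bar>B ?n k\<bar>) + (\<Sum>k. \<bar>B ?n (k + ?b)\<bar>)"
      unfolding N_def using suminf_split_initial_segment[OF row[of ?n], of ?b] by linarith
    have D: "D i = (\<Sum>k<?a. B ?n k * x k) + (\<Sum>k=?a..<?b. B ?n k * x k)
        + (\<Sum>k. B ?n (k + ?b) * x (k + ?b))"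
      unfolding D_def by (rule split[OF summable_rabs_cancel[OF sBx]])
    have "e \<le> N ?n" "(\<Sum>k<?a. \<bar>B ?n k\<bar>) \<le> e / 8" "(\<Sum>k. \<bar>B ?n (k + ?b)\<bar>) \<le> e / 8"
      using R[of i] N' by (auto simp: R_def)
    then have "\<bar>D i - (-1) ^ i * (\<Sum>k=?a..<?b. \<bar>B ?n k\<bar>)\<bar> \<le> e / 4"
      "3 / 4 * e \<le> (\<Sum>k=?a..<?b. \<bar>B ?n k\<bar>)"
      using D mid lo hi N by linarith+
    moreover have "e / 2 \<le> (-1) ^ i * d" if "\<bar>d - (-1) ^ i * t\<bar> \<le> e / 4" "3 / 4 * e \<le> t" for d t :: real
      using abs_le_D1[OF that(1)] abs_le_D2[OF that(1)] that(2) e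
      by (cases "even i") simp_all
    ultimately show ?thesis by blast
  qed
  \<comment> \<open>Along rows tending to infinity \<open>D\<close> inherits the limit of the
    transform, although consecutive values have opposite signs and modulus at least
    \<open>e / 2\<close>, hence stay \<open>e\<close> apart.\<close>
  have "filterlim \<nu> at_top sequentially"
  proof (rule filterlim_at_top_mono[OF filterlim_ident always_eventually], intro allI)
    fix i
    have "i \<le> s i" by (rule strict_mono_imp_increasing[OF sm])
    then show "i \<le> \<nu> i" using R[of i] by (simp add: R_def)
  qed
  moreover obtain L where "(\<lambda>n. \<Sum>k. B n k * x k) \<longlonglongrightarrow> L"
    using conv[of x, OF x1] by (auto simp: convergent_def)
  ultimately have "D \<longlonglongrightarrow> L"
    unfolding D_def[abs_def] by (rule filterlim_compose[rotated])
  then have "(\<lambda>i. D (Suc i) - D i) \<longlonglongrightarrow> 0"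
    using tendsto_diff[OF LIMSEQ_Suc] by fastforce
  then have "\<forall>\<^sub>F i in sequentially. \<bar>D (Suc i) - D i\<bar> < e"
    using e by (auto simp: tendsto_iff dist_real_def)
  then obtain i where "\<bar>D (Suc i) - D i\<bar> < e"
    by (auto simp: eventually_sequentially)
  with big[of i] big[of "Suc i"] show False
    by (cases "even i") auto
qed

subsection \<open>Triangular matrices mapping into the convergent sequences\<close>

text \<open>Translates finiteness in \<open>d4\<close>, \<open>d5\<close>, \<open>d6\<close> and
  \<open>d8\<close> into real bounds. That \<open>ennreal\<close> sends negative values to 0 is
  harmless, as a finite supremum equals \<open>ennreal C\<close> with
  \<open>0 \<le> C\<close>.\<close>

lemma SUP_ennreal_less_top_iff:
  "(SUP i\<in>I. ennreal (f i)) < \<infinity> \<longleftrightarrow> (\<exists>C. \<forall>i\<in>I. f i \<le> C)"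
proof
  assume L: "(SUP i\<in>I. ennreal (f i)) < \<infinity>"
  then obtain C where C: "0 \<le> C" "(SUP i\<in>I. ennreal (f i)) = ennreal C"
    by (cases "SUP i\<in>I. ennreal (f i)") auto
  have "f i \<le> C" if "i \<in> I" for i
  proof -
    have "ennreal (f i) \<le> ennreal C" unfolding C(2)[symmetric] using that by (rule SUP_upper)
    then show ?thesis using C(1) by (simp add: ennreal_le_iff)
  qed
  then show "\<exists>C. \<forall>i\<in>I. f i \<le> C" by blast
next
  assume "\<exists>C. \<forall>i\<in>I. f i \<le> C"
  then obtain C where C: "\<And>i. i \<in> I \<Longrightarrow> f i \<le> C" by blast
  have "(SUP i\<in>I. ennreal (f i)) \<le> ennreal C"
    by (intro SUP_least ennreal_leI C)
  then show "(SUP i\<in>I. ennreal (f i)) < \<infinity>"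
    by (simp add: order_le_less_trans)
qed

lemma ell_ereal: "ell (ereal r) = {x. summable (\<lambda>k. \<bar>x k\<bar> powr r)}"
  by (simp add: ell_def)

lemma ell_1: "ell 1 = {x. summable (\<lambda>k. \<bar>x k\<bar>)}"
  using ell_ereal[of 1] by (simp add: one_ereal_def)

lemma ell_infinity: "ell \<infinity> = {x. \<exists>M. \<forall>k. \<bar>x k\<bar> \<le> M}"
  by (auto simp: ell_def bounded_iff)

text \<open>For \<open>A\<close> vanishing above the diagonal the sum up to \<open>n\<close> is the
  whole row sum, so this is membership in the matrix class from \<open>X\<close> to the convergent
  sequences.\<close>

definition tri_into_c :: "(nat \<Rightarrow> nat \<Rightarrow> real) \<Rightarrow> (nat \<Rightarrow> real) set \<Rightarrow> bool" where
  "tri_into_c A X \<longleftrightarrow> (\<forall>y\<in>X. convergent (\<lambda>n. \<Sum>k\<le>n. A n k * y k))"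

text \<open>The unit vectors lie in \<open>ell p\<close> for every \<open>p\<close>, and the
  transform of the \<open>k\<close>-th one is the \<open>k\<close>-th column.\<close>

lemma tri_into_c_columns:
  assumes tri: "\<And>n k. n < k \<Longrightarrow> A n k = 0"
    and A: "tri_into_c A (ell p)"
  shows "convergent (\<lambda>n. A n k)"
proof -
  define e :: "nat \<Rightarrow> real" where "e j = (if j = k then 1 else 0)" for j
  have "e \<in> ell p"
  proof (cases "p = \<infinity>")
    case True
    have "\<bar>e j\<bar> \<le> 1" for j by (simp add: e_def)
    with True show ?thesis unfolding True ell_infinity by blast
  next
    case False
    have "summable (\<lambda>j. \<bar>e j\<bar> powr real_of_ereal p)"
      by (rule summable_finite[of "{k}"]) (auto simp: e_def)
    with False show ?thesis by (simp add: ell_def)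
  qed
  moreover have "(\<Sum>j\<le>n. A n j * e j) = A n k" for n
    using tri[of n k] by (cases "k \<le> n") (simp_all add: e_def if_distrib cong: if_cong)
  ultimately show ?thesis using A unfolding tri_into_c_def by force
qed

lemma convergent_columns_bounded:
  fixes A :: "nat \<Rightarrow> nat \<Rightarrow> real"
  assumes "\<And>k. convergent (\<lambda>n. A n k)"
  obtains B where "\<And>n k. \<bar>A n k\<bar> \<le> B k"
proof -
  have "\<exists>b. \<forall>n. \<bar>A n k\<bar> \<le> b" for k
    using convergent_imp_Bseq[OF assms[of k]] unfolding Bseq_def by auto
  then show ?thesis using that by metis
qed

text \<open>The hump argument as a refutation: the glued vector lies in \<open>X\<close>, but its
  transform is unbounded. Humps are requested only for \<open>e \<le> 1\<close>, so that smallness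
  of the sum of \<open>g\<close> can force entries of modulus at most 1.\<close>

lemma tri_into_c_no_hump:
  fixes A :: "nat \<Rightarrow> nat \<Rightarrow> real" and g :: "real \<Rightarrow> real"
  assumes A: "tri_into_c A X"
    and col: "\<And>k. convergent (\<lambda>n. A n k)"
    and g: "\<And>t. 0 \<le> g t"
    and X: "\<And>x. (\<And>k. \<bar>x k\<bar> \<le> 1) \<Longrightarrow> summable (\<lambda>k. g (x k)) \<Longrightarrow> x \<in> X"
    and block: "\<And>m M e. 0 < e \<Longrightarrow> e \<le> 1 \<Longrightarrow> \<exists>n\<ge>m. \<exists>u. (\<forall>k. \<bar>u k\<bar> \<le> 1) \<and>
                  (\<Sum>k=m..n. g (u k)) \<le> e \<and> M \<le> (\<Sum>k=m..n. A n k * u k)"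
  shows False
proof -
  obtain B where B: "\<And>n k. \<bar>A n k\<bar> \<le> B k"
    using convergent_columns_bounded[of A, OF col] by metis
  have block': "\<exists>n\<ge>m. \<exists>u. (\<forall>k. \<bar>u k\<bar> \<le> 1) \<and> (\<Sum>k=m..n. g (u k)) \<le> e \<and>
      M \<le> (\<Sum>k=m..n. A n k * u k)" if "0 < e" for m M e
  proof -
    have "0 < min e 1" using that by simp
    from block[OF this min.cobounded2, of m M]
    obtain n u where "n \<ge> m" "\<forall>k. \<bar>u k\<bar> \<le> 1" "(\<Sum>k=m..n. g (u k)) \<le> min e 1"
      "M \<le> (\<Sum>k=m..n. A n k * u k)"
      by blast
    then show ?thesis by (intro exI[of _ n] conjI exI[of _ u]) auto
  qed
  obtain x where x: "\<And>k. \<bar>x k\<bar> \<le> 1" "summable (\<lambda>k. g (x k))"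
    and unb: "\<And>M. \<exists>n. M \<le> (\<Sum>k\<le>n. A n k * x k)"
    using gliding_hump[where g = g, OF B block' g] by metis
  have "convergent (\<lambda>n. \<Sum>k\<le>n. A n k * x k)"
    using A X[OF x] by (simp add: tri_into_c_def)
  from convergent_imp_Bseq[OF this]
  obtain K where K: "\<And>n. \<bar>\<Sum>k\<le>n. A n k * x k\<bar> \<le> K"
    by (auto simp: Bseq_def)
  obtain n where "K + 1 \<le> (\<Sum>k\<le>n. A n k * x k)" using unb by blast
  with K[of n] show False by linarith
qed

text \<open>The first \<open>m\<close> columns contribute a bounded amount to every row, so
  unbounded row sums must become large beyond them.\<close>

lemma row_tail_large:
  fixes A :: "nat \<Rightarrow> nat \<Rightarrow> real"
  assumes B: "\<And>n k. \<bar>A n k\<bar> \<le> B k" and q: "0 \<le> q"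
    and unb: "\<nexists>C. \<forall>n. (\<Sum>k\<le>n. \<bar>A n k\<bar> powr q) \<le> C"
  obtains n where "m \<le> n" "M \<le> (\<Sum>k=m..n. \<bar>A n k\<bar> powr q)"
proof -
  have le: "(\<Sum>k<m. \<bar>A n k\<bar> powr q) \<le> (\<Sum>k<m. B k powr q)" for n
    by (intro sum_mono powr_mono2 q B) auto
  \<comment> \<open>Taking \<open>max M 0\<close> keeps the surplus over the first \<open>m\<close>
    columns nonnegative, which excludes rows with \<open>n < m\<close>.\<close>
  obtain n where n: "(\<Sum>k<m. B k powr q) + max M 0 < (\<Sum>k\<le>n. \<bar>A n k\<bar> powr q)"
    using unb by (metis not_le)
  have "m \<le> n"
  proof (rule ccontr)
    assume "\<not> m \<le> n"
    then have "(\<Sum>k\<le>n. \<bar>A n k\<bar> powr q) \<le> (\<Sum>k<m. \<bar>A n k\<bar> powr q)"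
      by (intro sum_mono2) auto
    with le[of n] n show False by linarith
  qed
  moreover from this have "(\<Sum>k\<le>n. \<bar>A n k\<bar> powr q) =
      (\<Sum>k<m. \<bar>A n k\<bar> powr q) + (\<Sum>k=m..n. \<bar>A n k\<bar> powr q)"
    by (subst sum.union_disjoint[symmetric]) (auto intro!: sum.cong)
  ultimately show ?thesis using that[of n] le[of n] n by linarith
qed

text \<open>Finite heads converge along with the columns; tails that are small uniformly in the row
  then make the transform Cauchy.\<close>

lemma convergent_triI:
  fixes A :: "nat \<Rightarrow> nat \<Rightarrow> real"
  assumes col: "\<And>k. convergent (\<lambda>n. A n k)"
    and tail: "\<And>e. 0 < e \<Longrightarrow> \<exists>K. \<forall>n. \<bar>\<Sum>k=K..n. A n k * y k\<bar> \<le> e"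
  shows "convergent (\<lambda>n. \<Sum>k\<le>n. A n k * y k)"
proof -
  have "Cauchy (\<lambda>n. \<Sum>k\<le>n. A n k * y k)"
  proof (rule CauchyI)
    fix e :: real assume e: "0 < e"
    obtain K where K: "\<And>n. \<bar>\<Sum>k=K..n. A n k * y k\<bar> \<le> e / 4"
      using tail[of "e / 4"] e by auto
    have "convergent (\<lambda>n. \<Sum>k<K. A n k * y k)"
      by (intro convergent_sum convergent_mult col convergent_const)
    then have "Cauchy (\<lambda>n. \<Sum>k<K. A n k * y k)" by (rule convergent_Cauchy)
    then obtain N where N: "\<And>m n. m \<ge> N \<Longrightarrow> n \<ge> N \<Longrightarrow>
        \<bar>(\<Sum>k<K. A m k * y k) - (\<Sum>k<K. A n k * y k)\<bar> < e / 4"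
      using CauchyD[of _ "e / 4"] e by fastforce
    have split: "(\<Sum>k\<le>n. A n k * y k) = (\<Sum>k<K. A n k * y k) + (\<Sum>k=K..n. A n k * y k)"
      if "K \<le> n" for n
      using that by (subst sum.union_disjoint[symmetric]) (auto intro!: sum.cong)
    have "norm ((\<Sum>k\<le>m. A m k * y k) - (\<Sum>k\<le>n. A n k * y k)) < e"
      if "m \<ge> max N K" "n \<ge> max N K" for m n
    proof -
      have "N \<le> m" "N \<le> n" "K \<le> m" "K \<le> n" using that by auto
      with N[of m n] K[of m] K[of n] split[of m] split[of n] show ?thesis
        unfolding real_norm_def by linarith
    qed
    then show "\<exists>M. \<forall>m\<ge>M. \<forall>n\<ge>M.
        norm ((\<Sum>k\<le>m. A m k * y k) - (\<Sum>k\<le>n. A n k * y k)) < e" by blast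
  qed
  then show ?thesis by (rule Cauchy_convergent)
qed

section \<open>Matrix classes from \<open>ell p\<close>, \<open>ell 1\<close> and
  \<open>ell \<infinity>\<close> into the convergent sequences\<close>

lemma summable_tail_small:
  fixes f :: "nat \<Rightarrow> real"
  assumes "summable f" "0 < e"
  obtains K where "\<And>n. sum f {K..n} < e"
proof -
  obtain K where K: "\<And>n. norm (sum f {K..<n}) < e"
    using assms unfolding summable_Cauchy by blast
  have "sum f {K..n} < e" for n
    using K[of "Suc n"] unfolding atLeastLessThanSuc_atLeastAtMost real_norm_def by linarith
  then show ?thesis by (rule that)
qed

text \<open>Necessity: if the row sums of \<open>q\<close>-th powers are unbounded, the equality
  case of Hoelder's inequality yields humps of small \<open>r\<close>-norm with large row values.
  Sufficiency: Young's inequality makes the tails uniformly small.\<close>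

lemma tri_into_c_ell_p_iff:
  fixes A :: "nat \<Rightarrow> nat \<Rightarrow> real" and r q :: real
  assumes tri: "\<And>n k. n < k \<Longrightarrow> A n k = 0"
    and r: "1 < r" and q: "q = r / (r - 1)"
  shows "tri_into_c A (ell (ereal r)) \<longleftrightarrow>
    (\<forall>k. convergent (\<lambda>n. A n k)) \<and> (\<exists>C. \<forall>n. (\<Sum>k\<le>n. \<bar>A n k\<bar> powr q) \<le> C)"
proof -
  have q1: "1 < q" and pq: "1 / q = 1 - 1 / r" "(q - 1) * r = q"
    using r by (simp_all add: q field_simps)
  have conj: "1 / q + 1 / r = 1" using pq(1) by simp
  show ?thesis
  proof (intro iffI conjI allI)
    assume A: "tri_into_c A (ell (ereal r))"
    show col: "convergent (\<lambda>n. A n k)" for k by (rule tri_into_c_columns[OF tri A])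
    obtain B where B: "\<And>n k. \<bar>A n k\<bar> \<le> B k"
      using convergent_columns_bounded[of A, OF col] by metis
    show "\<exists>C. \<forall>n. (\<Sum>k\<le>n. \<bar>A n k\<bar> powr q) \<le> C"
    proof (rule ccontr)
      assume unb: "\<nexists>C. \<forall>n. (\<Sum>k\<le>n. \<bar>A n k\<bar> powr q) \<le> C"
      show False
      proof (rule tri_into_c_no_hump[OF A col])
        show "0 \<le> \<bar>t\<bar> powr r" for t :: real by simp
        show "x \<in> ell (ereal r)" if "summable (\<lambda>k. \<bar>x k\<bar> powr r)" for x
          using that by (simp add: ell_ereal)
      next
        fix m and M e :: real assume e: "0 < e" "e \<le> 1"
        \<comment> \<open>Chosen so that \<open>e powr (1 / r) * T\<close> equals
          \<open>max M 1\<close>; a row mass \<open>S\<close> of at least \<open>T powr q\<close>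
          guarantees this row value. The maximum with 1 keeps \<open>T\<close> positive.\<close>
        define T where "T = max M 1 / e powr (1 / r)"
        have T: "0 < T" using e by (simp add: T_def)
        obtain n where n: "m \<le> n" "T powr q \<le> (\<Sum>k=m..n. \<bar>A n k\<bar> powr q)"
          using row_tail_large[where m = m and M = "T powr q", OF B _ unb] q1 by auto
        define S where "S = (\<Sum>k=m..n. \<bar>A n k\<bar> powr q)"
        have S: "0 < S" "T powr q \<le> S"
          using n T unfolding S_def by (auto intro: less_le_trans[of 0 "T powr q"])
        \<comment> \<open>the vector for which equality holds in Hoelder's inequality\<close>
        define u where
          "u k = (if k \<in> {m..n} then (e / S) powr (1 / r) * (sgn (A n k) * \<bar>A n k\<bar> powr (q - 1)) else 0)"
          for k
        have u_pow: "\<bar>u k\<bar> powr r = e / S * \<bar>A n k\<bar> powr q" if "k \<in> {m..n}" for k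
        proof (cases "A n k = 0")
          case True
          then show ?thesis using that by (simp add: u_def)
        next
          case False
          then have "\<bar>u k\<bar> = (e / S) powr (1 / r) * \<bar>A n k\<bar> powr (q - 1)"
            using that by (simp add: u_def abs_mult abs_sgn_eq)
          then show ?thesis
            using e S r by (simp add: powr_mult powr_powr pq(2))
        qed
        have u_sum: "(\<Sum>k=m..n. \<bar>u k\<bar> powr r) = e"
        proof -
          have "(\<Sum>k=m..n. \<bar>u k\<bar> powr r) = (\<Sum>k=m..n. e / S * \<bar>A n k\<bar> powr q)"
            by (intro sum.cong refl u_pow)
          also have "\<dots> = e / S * S" by (simp only: sum_distrib_left S_def)
          finally show ?thesis using S by simp
        qed
        \<comment> \<open>Here \<open>e \<le> 1\<close> enters: a single \<open>r\<close>-th power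
          is at most their sum, which is \<open>e\<close>.\<close>
        have u_le: "\<bar>u k\<bar> \<le> 1" for k
        proof (cases "k \<in> {m..n}")
          case True
          have "\<bar>u k\<bar> powr r \<le> (\<Sum>k=m..n. \<bar>u k\<bar> powr r)"
            by (rule member_le_sum[OF True]) auto
          then have le: "\<bar>u k\<bar> powr r \<le> 1" using e u_sum by simp
          show ?thesis
          proof (rule ccontr)
            assume "\<not> \<bar>u k\<bar> \<le> 1"
            then have "1 < \<bar>u k\<bar> powr r" using r by (intro gr_one_powr) auto
            with le show False by simp
          qed
        qed (auto simp: u_def)
        have "A n k * u k = (e / S) powr (1 / r) * \<bar>A n k\<bar> powr q" if "k \<in> {m..n}" for k
        proof -
          have "\<bar>A n k\<bar> * \<bar>A n k\<bar> powr (q - 1) = \<bar>A n k\<bar> powr q"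
            by (metis abs_ge_zero powr_mult_base add.commute diff_add_cancel)
          moreover have "A n k * (sgn (A n k) * \<bar>A n k\<bar> powr (q - 1)) = \<bar>A n k\<bar> * \<bar>A n k\<bar> powr (q - 1)"
            by (simp add: abs_sgn)
          ultimately show ?thesis using that by (simp add: u_def)
        qed
        then have "(\<Sum>k=m..n. A n k * u k) = (e / S) powr (1 / r) * S"
          by (simp add: sum_distrib_left[symmetric] S_def)
        \<comment> \<open>The exponents are conjugate, so \<open>S / S powr (1 / r)\<close> is
          \<open>S powr (1 / q)\<close>.\<close>
        also have "\<dots> = e powr (1 / r) * S powr (1 / q)"
          using e S by (simp add: pq(1) powr_diff powr_divide)
        also have "\<dots> \<ge> e powr (1 / r) * T"
        proof -
          have "(T powr q) powr (1 / q) \<le> S powr (1 / q)"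
            using S q1 by (intro powr_mono2) auto
          then have "T \<le> S powr (1 / q)" using T q1 by (simp add: powr_powr)
          then show ?thesis by (intro mult_left_mono) auto
        qed
        also have "e powr (1 / r) * T = max M 1" using e by (simp add: T_def)
        finally have "M \<le> (\<Sum>k=m..n. A n k * u k)" by simp
        with n(1) u_sum u_le show "\<exists>n\<ge>m. \<exists>u. (\<forall>k. \<bar>u k\<bar> \<le> 1) \<and>
            (\<Sum>k=m..n. \<bar>u k\<bar> powr r) \<le> e \<and> M \<le> (\<Sum>k=m..n. A n k * u k)"
          by (metis order_refl)
      qed
    qed
  next
    assume "(\<forall>k. convergent (\<lambda>n. A n k)) \<and> (\<exists>C. \<forall>n. (\<Sum>k\<le>n. \<bar>A n k\<bar> powr q) \<le> C)"
    then obtain C0 where col: "\<And>k. convergent (\<lambda>n. A n k)"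
      and C0: "\<And>n. (\<Sum>k\<le>n. \<bar>A n k\<bar> powr q) \<le> C0" by blast
    define C where "C = max C0 1"
    have C: "0 < C" "\<And>n. (\<Sum>k\<le>n. \<bar>A n k\<bar> powr q) \<le> C"
      unfolding C_def by (rule less_le_trans[OF zero_less_one max.cobounded2], rule order_trans[OF C0 max.cobounded1])
    show "tri_into_c A (ell (ereal r))"
      unfolding tri_into_c_def
    proof (intro ballI convergent_triI col)
      fix y and e :: real assume "y \<in> ell (ereal r)" and e: "0 < e"
      then have y: "summable (\<lambda>k. \<bar>y k\<bar> powr r)" by (simp add: ell_ereal)
      \<comment> \<open>A scaling ahead of Young's inequality: \<open>t powr q * C\<close> is
        \<open>e / 2\<close>, so the matrix part costs at most half of \<open>e\<close>. The
        division of \<open>y\<close> by \<open>t\<close> is paid for by a late start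
        \<open>K\<close> of the tail.\<close>
      define t where "t = (e / (2 * C)) powr (1 / q)"
      have t: "0 < t" "t powr q = e / (2 * C)"
        using e C q1 by (simp_all add: t_def powr_powr)
      obtain K where K: "\<And>n. (\<Sum>k=K..n. \<bar>y k\<bar> powr r) < e / 2 * t powr r"
        using summable_tail_small[OF y, of "e / 2 * t powr r"] e t by auto
      have "\<bar>\<Sum>k=K..n. A n k * y k\<bar> \<le> e" for n
      proof -
        have Young: "\<bar>A n k * y k\<bar> \<le> t powr q * \<bar>A n k\<bar> powr q + \<bar>y k\<bar> powr r / t powr r" for k
        proof -
          have "\<bar>A n k * y k\<bar> = (t * \<bar>A n k\<bar>) * (\<bar>y k\<bar> / t)"
            using t by (simp add: abs_mult)
          also have "\<dots> \<le> (t * \<bar>A n k\<bar>) powr q / q + (\<bar>y k\<bar> / t) powr r / r"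
            by (rule Youngs_inequality) (use q1 r t conj in auto)
          also have "\<dots> \<le> (t * \<bar>A n k\<bar>) powr q + (\<bar>y k\<bar> / t) powr r"
          proof (rule add_mono)
            have "x / c \<le> x" if "0 \<le> x" "1 < c" for x c :: real
              using that by (simp add: divide_le_eq mult_le_cancel_left1)
            then show "(t * \<bar>A n k\<bar>) powr q / q \<le> (t * \<bar>A n k\<bar>) powr q"
              "(\<bar>y k\<bar> / t) powr r / r \<le> (\<bar>y k\<bar> / t) powr r"
              using q1 r by auto
          qed
          finally show ?thesis using t by (simp add: powr_mult powr_divide)
        qed
        have "\<bar>\<Sum>k=K..n. A n k * y k\<bar> \<le> (\<Sum>k=K..n. \<bar>A n k * y k\<bar>)" by (rule sum_abs)
        also have "\<dots> \<le> (\<Sum>k=K..n. t powr q * \<bar>A n k\<bar> powr q + \<bar>y k\<bar> powr r / t powr r)"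
          by (rule sum_mono[OF Young])
        also have "\<dots> = t powr q * (\<Sum>k=K..n. \<bar>A n k\<bar> powr q) + (\<Sum>k=K..n. \<bar>y k\<bar> powr r) / t powr r"
          by (simp add: sum.distrib sum_distrib_left sum_divide_distrib)
        also have "\<dots> \<le> e / 2 + e / 2"
        proof (rule add_mono)
          have "(\<Sum>k=K..n. \<bar>A n k\<bar> powr q) \<le> (\<Sum>k\<le>n. \<bar>A n k\<bar> powr q)"
            by (intro sum_mono2) auto
          then have "(\<Sum>k=K..n. \<bar>A n k\<bar> powr q) \<le> C" using C(2)[of n] by linarith
          then have "t powr q * (\<Sum>k=K..n. \<bar>A n k\<bar> powr q) \<le> t powr q * C"
            by (intro mult_left_mono) auto
          also have "\<dots> = e / 2" using C(1) by (simp add: t(2))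
          finally show "t powr q * (\<Sum>k=K..n. \<bar>A n k\<bar> powr q) \<le> e / 2" .
          show "(\<Sum>k=K..n. \<bar>y k\<bar> powr r) / t powr r \<le> e / 2"
            using K[of n] t(1) by (simp add: divide_le_eq)
        qed
        finally show ?thesis by simp
      qed
      then show "\<exists>K. \<forall>n. \<bar>\<Sum>k=K..n. A n k * y k\<bar> \<le> e" by blast
    qed
  qed
qed

text \<open>For necessity a hump is one scaled unit vector placed at a large entry; bounded columns
  force large entries arbitrarily far to the right. For sufficiency the entry bound turns tails of
  \<open>y\<close> into tails of the transform.\<close>

lemma tri_into_c_ell_1_iff:
  fixes A :: "nat \<Rightarrow> nat \<Rightarrow> real"
  assumes tri: "\<And>n k. n < k \<Longrightarrow> A n k = 0"
  shows "tri_into_c A (ell 1) \<longleftrightarrow>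
    (\<forall>k. convergent (\<lambda>n. A n k)) \<and> (\<exists>C. \<forall>n k. \<bar>A n k\<bar> \<le> C)"
proof (intro iffI conjI allI)
  assume A: "tri_into_c A (ell 1)"
  show col: "convergent (\<lambda>n. A n k)" for k by (rule tri_into_c_columns[OF tri A])
  obtain B where B: "\<And>n k. \<bar>A n k\<bar> \<le> B k"
    using convergent_columns_bounded[of A, OF col] by metis
  have B0: "0 \<le> B k" for k using B[of 0 k] by linarith
  show "\<exists>C. \<forall>n k. \<bar>A n k\<bar> \<le> C"
  proof (rule ccontr)
    assume unb: "\<nexists>C. \<forall>n k. \<bar>A n k\<bar> \<le> C"
    show False
    proof (rule tri_into_c_no_hump[OF A col])
      show "0 \<le> \<bar>t\<bar>" for t :: real by simp
      show "x \<in> ell 1" if "summable (\<lambda>k. \<bar>x k\<bar>)" for x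
        using that by (simp add: ell_1)
    next
      fix m and M e :: real assume e: "0 < e" "e \<le> 1"
      \<comment> \<open>No entry in the first \<open>m\<close> columns exceeds this threshold, hence
        \<open>m \<le> k\<close>; the entry is nonzero, hence \<open>k \<le> n\<close> by
        triangularity; and scaled by \<open>e\<close> it still reaches \<open>M\<close>.\<close>
      obtain n k where nk: "sum B {..<m} + \<bar>M\<bar> / e < \<bar>A n k\<bar>"
        using unb by (meson not_le)
      have M: "0 \<le> \<bar>M\<bar> / e" using e by simp
      have sB: "0 \<le> sum B {..<m}" by (intro sum_nonneg B0)
      have "k \<le> n" using nk M sB tri[of n k] by (cases "k \<le> n") auto
      moreover have "m \<le> k"
      proof (rule ccontr)
        assume "\<not> m \<le> k"
        then have "B k \<le> sum B {..<m}" by (intro member_le_sum) (auto simp: B0)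
        with B[of n k] nk M show False by linarith
      qed
      moreover define u where "u j = (if j = k then e * sgn (A n k) else 0)" for j
      moreover have "(\<Sum>j=m..n. A n j * u j) = e * \<bar>A n k\<bar>"
        using \<open>k \<le> n\<close> \<open>m \<le> k\<close> by (simp add: u_def if_distrib abs_sgn mult_ac cong: if_cong)
      moreover have "(\<Sum>j=m..n. \<bar>u j\<bar>) = \<bar>e * sgn (A n k)\<bar>"
        using \<open>k \<le> n\<close> \<open>m \<le> k\<close> by (simp add: u_def if_distrib cong: if_cong)
      moreover have "\<bar>e * sgn (A n k)\<bar> \<le> e" using e by (simp add: abs_mult abs_sgn_eq)
      moreover have "M \<le> e * \<bar>A n k\<bar>"
      proof -
        have "\<bar>M\<bar> / e \<le> \<bar>A n k\<bar>" using nk sB by linarith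
        then have "\<bar>M\<bar> \<le> e * \<bar>A n k\<bar>" using e by (simp add: divide_le_eq mult.commute)
        then show ?thesis by linarith
      qed
      ultimately show "\<exists>n\<ge>m. \<exists>u. (\<forall>k. \<bar>u k\<bar> \<le> 1) \<and>
            (\<Sum>k=m..n. \<bar>u k\<bar>) \<le> e \<and> M \<le> (\<Sum>k=m..n. A n k * u k)"
        using e by (intro exI[of _ n] conjI exI[of _ u]) auto
    qed
  qed
next
  assume "(\<forall>k. convergent (\<lambda>n. A n k)) \<and> (\<exists>C. \<forall>n k. \<bar>A n k\<bar> \<le> C)"
  then obtain C0 where col: "\<And>k. convergent (\<lambda>n. A n k)"
    and C0: "\<And>n k. \<bar>A n k\<bar> \<le> C0" by blast
  define C where "C = max C0 1"
  have C: "0 < C" "\<And>n k. \<bar>A n k\<bar> \<le> C"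
    unfolding C_def by (rule less_le_trans[OF zero_less_one max.cobounded2], rule order_trans[OF C0 max.cobounded1])
  show "tri_into_c A (ell 1)"
    unfolding tri_into_c_def
  proof (intro ballI convergent_triI col)
    fix y and e :: real assume "y \<in> ell 1" and e: "0 < e"
    then have y: "summable (\<lambda>k. \<bar>y k\<bar>)" by (simp add: ell_1)
    obtain K where K: "\<And>n. (\<Sum>k=K..n. \<bar>y k\<bar>) < e / C"
      using summable_tail_small[OF y, of "e / C"] e C by auto
    have "\<bar>\<Sum>k=K..n. A n k * y k\<bar> \<le> e" for n
    proof -
      have "\<bar>\<Sum>k=K..n. A n k * y k\<bar> \<le> (\<Sum>k=K..n. \<bar>A n k * y k\<bar>)" by (rule sum_abs)
      also have "\<dots> \<le> (\<Sum>k=K..n. C * \<bar>y k\<bar>)"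
        by (intro sum_mono) (simp add: abs_mult mult_right_mono C(2))
      also have "\<dots> = C * (\<Sum>k=K..n. \<bar>y k\<bar>)" by (simp add: sum_distrib_left)
      also have "\<dots> \<le> e" using K[of n] C(1) by (simp add: less_divide_eq mult.commute)
      finally show ?thesis .
    qed
    then show "\<exists>K. \<forall>n. \<bar>\<Sum>k=K..n. A n k * y k\<bar> \<le> e" by blast
  qed
qed

text \<open>A Fatou argument: letting the row index tend to infinity, each finite head of the limit
  row inherits the bound on the row sums.\<close>

lemma tri_limit_summable:
  fixes A :: "nat \<Rightarrow> nat \<Rightarrow> real"
  assumes lim: "\<And>k. (\<lambda>n. A n k) \<longlonglongrightarrow> a k"
    and C: "\<And>n. (\<Sum>k\<le>n. \<bar>A n k\<bar>) \<le> C"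
  shows "summable (\<lambda>k. \<bar>a k\<bar>)"
proof (rule summableI_nonneg_bounded)
  fix K
  have "(\<lambda>n. \<Sum>k<K. \<bar>A n k\<bar>) \<longlonglongrightarrow> (\<Sum>k<K. \<bar>a k\<bar>)"
    by (intro tendsto_intros lim)
  moreover have "(\<Sum>k<K. \<bar>A n k\<bar>) \<le> C" if "n \<ge> K" for n
  proof -
    have "(\<Sum>k<K. \<bar>A n k\<bar>) \<le> (\<Sum>k\<le>n. \<bar>A n k\<bar>)" using that by (intro sum_mono2) auto
    then show ?thesis using C[of n] by linarith
  qed
  ultimately show "(\<Sum>k<K. \<bar>a k\<bar>) \<le> C" by (blast intro: LIMSEQ_le_const2)
qed simp

lemma tri_row_diff_summable:
  fixes A :: "nat \<Rightarrow> nat \<Rightarrow> real"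
  assumes tri: "\<And>n k. n < k \<Longrightarrow> A n k = 0" and a: "summable (\<lambda>k. \<bar>a k\<bar>)"
  shows "summable (\<lambda>k. \<bar>A n k - a k\<bar>)"
proof -
  have "summable (\<lambda>k. \<bar>A n k\<bar>)"
    by (rule summable_finite[of "{..n}"]) (auto simp: tri)
  from summable_add[OF this a] show ?thesis
    by (rule summable_comparison_test') auto
qed

text \<open>Necessity: sign vectors as humps bound the row sums, so the limit row \<open>a\<close>
  is summable; after subtracting it the columns are null and Schur's lemma applies. Sufficiency: the
  transform of \<open>y\<close> tends to the sum of \<open>a k * y k\<close>, the error being at
  most a bound of \<open>y\<close> times the distance of the row from \<open>a\<close>.\<close>

lemma tri_into_c_ell_infinity_iff:
  fixes A :: "nat \<Rightarrow> nat \<Rightarrow> real"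
  assumes tri: "\<And>n k. n < k \<Longrightarrow> A n k = 0"
  shows "tri_into_c A (ell \<infinity>) \<longleftrightarrow>
    (\<forall>k. convergent (\<lambda>n. A n k)) \<and> (\<exists>C. \<forall>n. (\<Sum>k\<le>n. \<bar>A n k\<bar>) \<le> C) \<and>
    (\<lambda>n. \<Sum>k. \<bar>A n k - lim (\<lambda>n. A n k)\<bar>) \<longlonglongrightarrow> 0"
proof -
  define a where "a k = lim (\<lambda>n. A n k)" for k
  have sums: "(\<lambda>k. A n k * y k) sums (\<Sum>k\<le>n. A n k * y k)" for n and y :: "nat \<Rightarrow> real"
    by (rule sums_finite) (auto simp: tri)
  have abs_sm: "summable (\<lambda>k. \<bar>b k * y k\<bar>)" if "summable (\<lambda>k. \<bar>b k\<bar>)" "\<And>k. \<bar>y k\<bar> \<le> M"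
    for M and b y :: "nat \<Rightarrow> real"
    by (rule summable_comparison_test'[OF summable_mult[OF that(1), of M]])
      (use that(2) in \<open>auto simp: abs_mult mult.commute[of M] intro!: mult_left_mono\<close>)
  have diff: "(\<Sum>k. (A n k - a k) * y k) = (\<Sum>k\<le>n. A n k * y k) - (\<Sum>k. a k * y k)"
    if "summable (\<lambda>k. \<bar>a k\<bar>)" "\<And>k. \<bar>y k\<bar> \<le> M" for n M and y :: "nat \<Rightarrow> real"
    using suminf_diff[OF sums_summable[OF sums[of n y]]
        summable_rabs_cancel[OF abs_sm[where b = a and y = y, OF that]]]
    by (simp add: left_diff_distrib sums_unique[OF sums[of n y], symmetric])
  show ?thesis unfolding a_def[symmetric]
  proof (intro iffI conjI allI)
    assume A: "tri_into_c A (ell \<infinity>)"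
    show col: "convergent (\<lambda>n. A n k)" for k by (rule tri_into_c_columns[OF tri A])
    then have lim: "(\<lambda>n. A n k) \<longlonglongrightarrow> a k" for k
      by (simp add: a_def convergent_LIMSEQ_iff)
    obtain B where B: "\<And>n k. \<bar>A n k\<bar> \<le> B k"
      using convergent_columns_bounded[of A, OF col] by metis
    show bd: "\<exists>C. \<forall>n. (\<Sum>k\<le>n. \<bar>A n k\<bar>) \<le> C"
    proof (rule ccontr)
      assume unb: "\<nexists>C. \<forall>n. (\<Sum>k\<le>n. \<bar>A n k\<bar>) \<le> C"
      show False
      \<comment> \<open>The zero function for \<open>g\<close> encodes that there is no summability
        requirement: entries bounded by 1 already give a member of
        \<open>ell \<infinity>\<close>.\<close>
      proof (rule tri_into_c_no_hump[OF A col, of "\<lambda>_. 0"])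
        show "x \<in> ell \<infinity>" if "\<And>k. \<bar>x k\<bar> \<le> 1" for x
          using that by (auto simp: ell_infinity)
      next
        fix m and M e :: real assume e: "0 < e"
        obtain n where n: "m \<le> n" "M \<le> (\<Sum>k=m..n. \<bar>A n k\<bar>)"
          using row_tail_large[where A = A and B = B and m = m and M = M and q = 1] B unb by auto
        show "\<exists>n\<ge>m. \<exists>u. (\<forall>k. \<bar>u k\<bar> \<le> 1) \<and> (\<Sum>k=m..n. 0) \<le> e \<and> M \<le> (\<Sum>k=m..n. A n k * u k)"
          using n e by (intro exI[of _ n] conjI exI[of _ "\<lambda>k. sgn (A n k)"])
            (auto simp: abs_sgn_eq abs_sgn[symmetric])
      qed auto
    qed
    then have a: "summable (\<lambda>k. \<bar>a k\<bar>)"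
      using tri_limit_summable[of A a, OF lim] by blast
    show "(\<lambda>n. \<Sum>k. \<bar>A n k - a k\<bar>) \<longlonglongrightarrow> 0"
    proof (rule schur_matrix)
      show "summable (\<lambda>k. \<bar>A n k - a k\<bar>)" for n by (rule tri_row_diff_summable[OF tri a])
      show "(\<lambda>n. A n k - a k) \<longlonglongrightarrow> 0" for k using lim[of k] by (rule LIM_zero)
      fix x :: "nat \<Rightarrow> real" assume x: "\<And>k. \<bar>x k\<bar> \<le> 1"
      then have "convergent (\<lambda>n. \<Sum>k\<le>n. A n k * x k)"
        using A by (auto simp: tri_into_c_def ell_infinity)
      then show "convergent (\<lambda>n. \<Sum>k. (A n k - a k) * x k)"
        by (simp add: diff[OF a x] convergent_diff convergent_const)
    qed
  next
    assume R: "(\<forall>k. convergent (\<lambda>n. A n k)) \<and> (\<exists>C. \<forall>n. (\<Sum>k\<le>n. \<bar>A n k\<bar>) \<le> C) \<and>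
      (\<lambda>n. \<Sum>k. \<bar>A n k - a k\<bar>) \<longlonglongrightarrow> 0"
    then have lim: "(\<lambda>n. A n k) \<longlonglongrightarrow> a k" for k
      by (simp add: a_def convergent_LIMSEQ_iff)
    have a: "summable (\<lambda>k. \<bar>a k\<bar>)"
      using R tri_limit_summable[of A a, OF lim] by blast
    show "tri_into_c A (ell \<infinity>)"
      unfolding tri_into_c_def
    proof
      fix y assume "y \<in> ell \<infinity>"
      then obtain M where M: "\<And>k. \<bar>y k\<bar> \<le> M" by (auto simp: ell_infinity)
      have "\<bar>(\<Sum>k\<le>n. A n k * y k) - (\<Sum>k. a k * y k)\<bar> \<le> M * (\<Sum>k. \<bar>A n k - a k\<bar>)" for n
      proof -
        note row = tri_row_diff_summable[of A a n, OF tri a]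
        note rowy = abs_sm[where b = "\<lambda>k. A n k - a k" and y = y, OF row M]
        have "\<bar>\<Sum>k. (A n k - a k) * y k\<bar> \<le> (\<Sum>k. \<bar>(A n k - a k) * y k\<bar>)"
          by (rule summable_rabs[OF rowy])
        also have "\<dots> \<le> (\<Sum>k. M * \<bar>A n k - a k\<bar>)"
          by (intro suminf_le rowy summable_mult row)
            (use M in \<open>auto simp: abs_mult mult.commute[of M] intro!: mult_left_mono\<close>)
        also have "\<dots> = M * (\<Sum>k. \<bar>A n k - a k\<bar>)" by (rule suminf_mult[OF row])
        finally show ?thesis by (simp add: diff[OF a M])
      qed
      moreover have "(\<lambda>n. M * (\<Sum>k. \<bar>A n k - a k\<bar>)) \<longlonglongrightarrow> 0"
        using R by (auto intro: tendsto_mult_right_zero)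
      ultimately have "(\<lambda>n. (\<Sum>k\<le>n. A n k * y k) - (\<Sum>k. a k * y k)) \<longlonglongrightarrow> 0"
        unfolding real_norm_def[symmetric]
        by (rule Lim_null_comparison[OF always_eventually[OF allI]])
      then show "convergent (\<lambda>n. \<Sum>k\<le>n. A n k * y k)"
        by (rule convergentI[OF LIM_zero_cancel])
    qed
  qed
qed

subsection \<open>The inverse of the transformation E\<close>

lemma prev_Suc [simp]: "prev x (Suc k) = x k" and prev_0 [simp]: "prev x 0 = 0"
  by (simp_all add: prev_def)

lemma fibr_pos [simp]: "0 < fibr k"
  unfolding fibr_def by (simp add: fib_neq_0_nat)

lemma fibr_neq_0 [simp]: "fibr k \<noteq> 0"
  using fibr_pos[of k] by linarith

lemma fibr_Suc_Suc: "fibr (Suc (Suc k)) = fibr (Suc k) + fibr k"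
  by (simp add: fibr_def)

locale lambda_sequence =
  fixes lam :: "nat \<Rightarrow> real"
  assumes mono: "strict_mono lam" and pos: "0 < lam k"
begin

text \<open>The factor that appears when the \<open>k\<close>-th difference equation is solved for
  \<open>x k\<close>; the bracket in \<open>abar\<close> is its decrease from \<open>k\<close> to
  \<open>Suc k\<close>.\<close>

definition weight :: "nat \<Rightarrow> real" where
  "weight k = 1 / ((lam k - prev lam k) * fibr k * fibr (k+1))"

text \<open>The inverse of \<open>E lam\<close>: it sums up the increments that
  \<open>E lam x = y\<close> prescribes for \<open>x k / (fibr (k+1))\<^sup>2\<close>.\<close>

definition E_inv :: "(nat \<Rightarrow> real) \<Rightarrow> nat \<Rightarrow> real" where
  "E_inv y k = (fibr (k+1))\<^sup>2 * (\<Sum>j\<le>k. weight j * (lam j * y j - prev (\<lambda>i. lam i * y i) j))"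

lemma lam_diff_pos: "0 < lam k - prev lam k"
  using mono pos by (cases k) (auto simp: strict_mono_Suc_iff)

lemma lam_neq_0 [simp]: "lam k \<noteq> 0"
  using pos[of k] by linarith

text \<open>Multiplying by \<open>lam n\<close> and differencing in \<open>n\<close> isolates one
  summand; summing the differences back telescopes.\<close>

lemma E_eq_iff:
  "E lam x = y \<longleftrightarrow> (\<forall>k. (lam k - prev lam k) * (fibr k / fibr (k+1) * x k
     - fibr (k+1) / fibr k * prev x k) = lam k * y k - prev (\<lambda>i. lam i * y i) k)"
    (is "_ \<longleftrightarrow> (\<forall>k. ?t k = ?d k)")
proof -
  have "E lam x = y \<longleftrightarrow> (\<forall>n. sum ?t {..n} = lam n * y n)"
    by (simp add: E_def fun_eq_iff divide_eq_eq mult.commute)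
  also have "\<dots> \<longleftrightarrow> (\<forall>k. ?t k = ?d k)"
  proof (intro iffI allI)
    fix k assume "\<forall>n. sum ?t {..n} = lam n * y n"
    then show "?t k = ?d k"
    proof (cases k)
      case (Suc m)
      from \<open>\<forall>n. sum ?t {..n} = lam n * y n\<close>
      have "sum ?t {..Suc m} = lam (Suc m) * y (Suc m)" "sum ?t {..m} = lam m * y m" by blast+
      then show ?thesis unfolding Suc sum.atMost_Suc prev_Suc by linarith
    next
      case 0
      from \<open>\<forall>n. sum ?t {..n} = lam n * y n\<close> have "sum ?t {..0} = lam 0 * y 0" by blast
      then show ?thesis by (simp add: 0)
    qed
  next
    fix n assume *: "\<forall>k. ?t k = ?d k"
    have "sum ?d {..n} = lam n * y n"
      by (induction n) simp_all
    with * show "sum ?t {..n} = lam n * y n" by simp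
  qed
  finally show ?thesis .
qed

text \<open>Each equation fixes the increment of \<open>x k / (fibr (k+1))\<^sup>2\<close> as
  \<open>weight k * d k\<close>, and the preceding term of the first one is 0. Summation gives the
  only solution, so \<open>E lam\<close> is a bijection of all real sequences.\<close>

lemma E_eq_iff_E_inv: "E lam x = y \<longleftrightarrow> x = E_inv y"
proof -
  define d where "d k = lam k * y k - prev (\<lambda>i. lam i * y i) k" for k
  have E_inv0: "E_inv y 0 = weight 0 * d 0"
    by (simp add: E_inv_def d_def fibr_1[unfolded One_nat_def])
  have E_invS: "E_inv y (Suc k) = (fibr (Suc (Suc k)))\<^sup>2 * (weight (Suc k) * d (Suc k)
      + E_inv y k / (fibr (Suc k))\<^sup>2)" for k
    by (simp add: E_inv_def d_def algebra_simps)
  have step: "(lam k - prev lam k) * (fibr k / fibr (k+1) * x k - fibr (k+1) / fibr k * prev x k) = d k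
      \<longleftrightarrow> x k = (fibr (Suc k))\<^sup>2 * (weight k * d k + prev x k / (fibr k)\<^sup>2)" for k
  proof -
    define l F G where "l = lam k - prev lam k" and "F = fibr k" and "G = fibr (Suc k)"
    have pos: "l \<noteq> 0" "F \<noteq> 0" "G \<noteq> 0"
      using lam_diff_pos[of k] by (auto simp: l_def F_def G_def)
    have "l * (F / G * u - G / F * v) = c \<longleftrightarrow> u = G\<^sup>2 * (1 / (l * F * G) * c + v / F\<^sup>2)" for u v c
    proof
      assume c: "l * (F / G * u - G / F * v) = c"
      show "u = G\<^sup>2 * (1 / (l * F * G) * c + v / F\<^sup>2)"
        unfolding c[symmetric] using pos by (simp add: field_simps power2_eq_square)
    next
      assume u: "u = G\<^sup>2 * (1 / (l * F * G) * c + v / F\<^sup>2)"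
      show "l * (F / G * u - G / F * v) = c"
        unfolding u using pos by (simp add: field_simps power2_eq_square)
    qed
    then show ?thesis by (simp add: weight_def l_def F_def G_def)
  qed
  have "E lam x = y \<longleftrightarrow> (\<forall>k. x k = (fibr (Suc k))\<^sup>2 * (weight k * d k + prev x k / (fibr k)\<^sup>2))"
    unfolding E_eq_iff d_def[symmetric] step ..
  also have "\<dots> \<longleftrightarrow> (\<forall>k. x k = E_inv y k)"
  proof (intro iffI allI)
    fix k assume *: "\<forall>k. x k = (fibr (Suc k))\<^sup>2 * (weight k * d k + prev x k / (fibr k)\<^sup>2)"
    show "x k = E_inv y k"
    proof (induction k)
      case 0
      show ?case using spec[OF *, of 0] by (simp add: E_inv0 fibr_1[unfolded One_nat_def])
    next
      case (Suc k)
      then show ?case using spec[OF *, of "Suc k"] by (simp add: E_invS)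
    qed
  next
    fix k assume *: "\<forall>k. x k = E_inv y k"
    show "x k = (fibr (Suc k))\<^sup>2 * (weight k * d k + prev x k / (fibr k)\<^sup>2)"
      by (cases k) (simp_all add: * E_invS E_inv0 fibr_1[unfolded One_nat_def])
  qed
  finally show ?thesis by (simp add: fun_eq_iff)
qed

section \<open>The matrix \<open>abar\<close> and the transfer of the dual to it\<close>

lemma abar_triangular: "n < k \<Longrightarrow> abar lam a n k = 0"
  by (simp add: abar_def)

lemma abar_weight:
  assumes "k \<le> n"
  shows "abar lam a n k = lam k * ((fibr (k+1))\<^sup>2 * a k * weight k
    + (weight k - weight (Suc k)) * (\<Sum>j=Suc k..n. (fibr (j+1))\<^sup>2 * a j))"
  using assms by (simp add: abar_def weight_def mult.commute)

lemma abar_diagonal: "abar lam a n n = lam n * (fibr (n+1))\<^sup>2 * a n * weight n"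
  by (simp add: abar_weight)

lemma abar_Suc:
  assumes "k \<le> n"
  shows "abar lam a (Suc n) k =
    abar lam a n k + (fibr (n+2))\<^sup>2 * a (Suc n) * (lam k * (weight k - weight (Suc k)))"
  using assms by (simp add: abar_weight algebra_simps)

text \<open>From row \<open>n\<close> to row \<open>Suc n\<close> every old column gains a multiple
  of \<open>a (Suc n) * (fibr (n+2))\<^sup>2\<close>; with the new diagonal term these gains add up
  to \<open>a (Suc n) * E_inv y (Suc n)\<close>.\<close>

lemma sum_E_inv: "(\<Sum>k\<le>n. a k * E_inv y k) = (\<Sum>k\<le>n. abar lam a n k * y k)"
proof (induction n)
  case 0
  show ?case by (simp add: E_inv_def abar_weight)
next
  case (Suc n)
  \<comment> \<open>Summation by parts moves the difference from the weights to
    \<open>lam j * y j\<close>, giving the sum inside \<open>E_inv\<close>.\<close>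
  have bracket: "(\<Sum>k\<le>n. lam k * (weight k - weight (Suc k)) * y k) + lam (Suc n) * weight (Suc n) * y (Suc n)
      = (\<Sum>j\<le>Suc n. weight j * (lam j * y j - prev (\<lambda>i. lam i * y i) j))" for n
    by (induction n) (simp_all add: algebra_simps)
  have "(\<Sum>k\<le>Suc n. abar lam a (Suc n) k * y k)
      = (\<Sum>k\<le>n. abar lam a n k * y k) + (fibr (n+2))\<^sup>2 * a (Suc n) *
        ((\<Sum>k\<le>n. lam k * (weight k - weight (Suc k)) * y k) + lam (Suc n) * weight (Suc n) * y (Suc n))"
  proof -
    have "(\<Sum>k\<le>n. abar lam a (Suc n) k * y k) = (\<Sum>k\<le>n. abar lam a n k * y k
        + (fibr (n+2))\<^sup>2 * a (Suc n) * (lam k * (weight k - weight (Suc k)) * y k))"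
      by (intro sum.cong) (simp_all add: abar_Suc distrib_right)
    then show ?thesis
      by (simp add: abar_diagonal sum.distrib sum_distrib_left[symmetric] distrib_left)
  qed
  also have "\<dots> = (\<Sum>k\<le>n. a k * E_inv y k) + a (Suc n) * E_inv y (Suc n)"
    unfolding bracket Suc.IH[symmetric] E_inv_def[of y "Suc n"] by (simp add: mult_ac)
  finally show ?case by simp
qed

text \<open>\<open>E_inv\<close> parametrises the space by \<open>ell p\<close>, and under it the
  partial sums of the series become row sums of \<open>abar\<close>.\<close>

lemma beta_dual_iff: "a \<in> beta_dual (ell_lam_F lam p) \<longleftrightarrow> tri_into_c (abar lam a) (ell p)"
proof -
  have "a \<in> beta_dual (ell_lam_F lam p) \<longleftrightarrow> (\<forall>y\<in>ell p. summable (\<lambda>k. a k * E_inv y k))"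
    unfolding beta_dual_def ell_lam_F_def by simp (metis E_eq_iff_E_inv)
  also have "\<dots> \<longleftrightarrow> tri_into_c (abar lam a) (ell p)"
    by (simp add: tri_into_c_def summable_iff_convergent' sum_E_inv)
  finally show ?thesis .
qed

section \<open>Convergence of the columns and \<open>d3\<close>\<close>

lemma weight_nonconstant:
  assumes "filterlim lam at_top sequentially"
  obtains k where "weight k \<noteq> weight (Suc k)"
proof -
  have False if "\<forall>k. weight k = weight (Suc k)"
  proof -
    \<comment> \<open>Since \<open>fibr (Suc (Suc k))\<close> is at least \<open>2 * fibr k\<close>,
      equal weights shrink the increments of \<open>lam\<close> at least by half.\<close>
    have inc: "lam (Suc k) - lam k \<le> (lam k - prev lam k) / 2" for k
    proof -
      have "(lam (Suc k) - lam k) * fibr (Suc k) * fibr (Suc (Suc k)) =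
          (lam k - prev lam k) * fibr k * fibr (Suc k)"
        using that[rule_format, of k] lam_diff_pos[of k] lam_diff_pos[of "Suc k"]
        by (simp add: weight_def)
      then have eq: "(lam (Suc k) - lam k) * fibr (Suc (Suc k)) = (lam k - prev lam k) * fibr k"
        by simp
      have "fibr k \<le> fibr (Suc k)" by (simp add: fibr_def fib_mono)
      then have "(lam (Suc k) - lam k) * (2 * fibr k) \<le> (lam (Suc k) - lam k) * fibr (Suc (Suc k))"
        using lam_diff_pos[of "Suc k"] by (intro mult_left_mono) (auto simp: fibr_Suc_Suc)
      then have "(lam (Suc k) - lam k) * 2 * fibr k \<le> (lam k - prev lam k) * fibr k"
        unfolding eq by (simp add: mult_ac)
      then show ?thesis by (simp add: mult_le_cancel_right)
    qed
    \<comment> \<open>The current increment bounds all later ones together, so \<open>lam n\<close>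
      plus it does not increase with \<open>n\<close>; at 0 it is \<open>2 * lam 0\<close>.\<close>
    have "lam n + (lam n - prev lam n) \<le> 2 * lam 0" for n
    proof (induction n)
      case (Suc n)
      then show ?case using inc[of n] by simp
    qed simp
    then have "lam n \<le> 2 * lam 0" for n
      using lam_diff_pos[of n] by (metis add_increasing2 le_add_same_cancel1 less_imp_le order_trans)
    moreover obtain n where "2 * lam 0 < lam n"
      using assms unfolding filterlim_at_top_dense eventually_sequentially by blast
    ultimately show False by (meson not_le)
  qed
  then show ?thesis using that by blast
qed

text \<open>From \<open>n = k\<close> on, the column is an affine function of the partial sums of
  one fixed series; its slope \<open>c\<close> vanishes exactly when the two weights agree.\<close>

lemma convergent_abar_iff:
  "convergent (\<lambda>n. abar lam a n k) \<longleftrightarrow>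
     weight k = weight (Suc k) \<or> summable (\<lambda>j. a j * (fibr (j+1))\<^sup>2)"
proof -
  define c where "c = lam k * (weight k - weight (Suc k))"
  define S where "S n = (\<Sum>j\<le>n. a j * (fibr (j+1))\<^sup>2)" for n
  define b where "b = lam k * ((fibr (k+1))\<^sup>2 * a k * weight k) - c * S k"
  have abar: "abar lam a n k = b + c * S n" if "k \<le> n" for n
  proof -
    have "S n = S k + (\<Sum>j=Suc k..n. (fibr (j+1))\<^sup>2 * a j)"
      unfolding S_def using that
      by (subst mult.commute, subst sum.union_disjoint[symmetric]) (auto intro!: sum.cong simp: mult.commute)
    then show ?thesis using that by (simp add: abar_weight b_def c_def algebra_simps)
  qed
  have "convergent (\<lambda>n. abar lam a n k) \<longleftrightarrow> convergent (\<lambda>n. b + c * S n)"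
    by (intro convergent_cong eventually_sequentiallyI[of k] abar)
  also have "\<dots> \<longleftrightarrow> c = 0 \<or> convergent S"
    by (cases "c = 0")
      (simp_all add: convergent_add_const_iff convergent_mult_const_iff convergent_const)
  also have "convergent S \<longleftrightarrow> summable (\<lambda>j. a j * (fibr (j+1))\<^sup>2)"
    by (simp add: S_def[abs_def] summable_iff_convergent')
  also have "c = 0 \<longleftrightarrow> weight k = weight (Suc k)" by (simp add: c_def)
  finally show ?thesis .
qed

text \<open>All series in \<open>d3\<close> are tails of one series and converge together with
  it.\<close>

lemma mem_d3_iff: "a \<in> d3 \<longleftrightarrow> summable (\<lambda>j. a j * (fibr (j+1))\<^sup>2)"
proof -
  have "summable (\<lambda>i. a (k+1+i) * (fibr (k+1+i+1))\<^sup>2) \<longleftrightarrow> summable (\<lambda>j. a j * (fibr (j+1))\<^sup>2)" for k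
    using summable_iff_shift[of "\<lambda>j. a j * (fibr (j+1))\<^sup>2" "k + 1"] by (simp add: add_ac)
  then show ?thesis by (simp only: d3_def mem_Collect_eq) blast
qed

text \<open>A single convergent column with unequal neighbouring weights already recovers the series
  of \<open>d3\<close>.\<close>

lemma columns_convergent_iff_d3:
  assumes "filterlim lam at_top sequentially"
  shows "(\<forall>k. convergent (\<lambda>n. abar lam a n k)) \<longleftrightarrow> a \<in> d3"
  using weight_nonconstant[OF assms] unfolding convergent_abar_iff mem_d3_iff by metis

section \<open>The sets \<open>d4\<close> to \<open>d8\<close> as conditions on the matrix\<close>

lemma mem_d5_iff: "a \<in> d5 lam \<longleftrightarrow> (\<exists>C. \<forall>n. \<bar>abar lam a n n\<bar> \<le> C)"
proof -
  \<comment> \<open>On the diagonal the inner sum of \<open>abar\<close> is empty and only its first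
    term remains.\<close>
  have "lam n * (fibr (n+1))\<^sup>2 / ((lam n - prev lam n) * fibr n * fibr (n+1)) * a n = abar lam a n n" for n
    by (simp add: abar_diagonal weight_def)
  then show ?thesis by (simp only: d5_def mem_Collect_eq SUP_ennreal_less_top_iff) simp
qed

lemma mem_d6_iff: "a \<in> d6 lam \<longleftrightarrow> (\<exists>C. \<forall>n k. \<bar>abar lam a n k\<bar> \<le> C)"
proof -
  \<comment> \<open>The iterated supremum is merged into one over pairs, to which the finiteness
    criterion applies.\<close>
  have "(SUP n. SUP k. ennreal \<bar>abar lam a n k\<bar>) = (SUP z. ennreal \<bar>abar lam a (fst z) (snd z)\<bar>)"
  proof (rule antisym)
    show "(SUP n. SUP k. ennreal \<bar>abar lam a n k\<bar>) \<le> (SUP z. ennreal \<bar>abar lam a (fst z) (snd z)\<bar>)"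
    proof (intro SUP_least)
      fix n k
      show "ennreal \<bar>abar lam a n k\<bar> \<le> (SUP z. ennreal \<bar>abar lam a (fst z) (snd z)\<bar>)"
        by (rule SUP_upper2[of "(n, k)"]) simp_all
    qed
  qed (auto intro!: SUP_least intro: SUP_upper2)
  then show ?thesis
    by (simp only: d6_def mem_Collect_eq SUP_ennreal_less_top_iff) auto
qed

lemma suminf_abar: "(\<Sum>k. ennreal \<bar>abar lam a n k\<bar>) = ennreal (\<Sum>k\<le>n. \<bar>abar lam a n k\<bar>)"
  by (subst suminf_finite[of "{..n}"]) (auto simp: abar_triangular)

lemma mem_d8_iff: "a \<in> d8 lam \<longleftrightarrow> (\<exists>C. \<forall>n. (\<Sum>k\<le>n. \<bar>abar lam a n k\<bar>) \<le> C)"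
  by (simp only: d8_def mem_Collect_eq suminf_abar SUP_ennreal_less_top_iff) simp

lemma mem_d4_iff: "a \<in> d4 lam q \<longleftrightarrow> (\<exists>C. \<forall>n. (\<Sum>k<n. \<bar>abar lam a n k\<bar> powr q) \<le> C)"
  by (simp only: d4_def mem_Collect_eq SUP_ennreal_less_top_iff) simp

text \<open>The sum in \<open>d4\<close> stops just before the diagonal entry, and \<open>d5\<close>
  bounds that entry; together they control the full row sums of the matrix criterion.\<close>

lemma mem_d4_d5_iff:
  assumes "0 < q"
  shows "a \<in> d4 lam q \<and> a \<in> d5 lam \<longleftrightarrow> (\<exists>C. \<forall>n. (\<Sum>k\<le>n. \<bar>abar lam a n k\<bar> powr q) \<le> C)"
proof -
  have split: "(\<Sum>k\<le>n. \<bar>abar lam a n k\<bar> powr q)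
      = (\<Sum>k<n. \<bar>abar lam a n k\<bar> powr q) + \<bar>abar lam a n n\<bar> powr q" for n
    by (simp add: lessThan_Suc_atMost[symmetric])
  show ?thesis unfolding mem_d4_iff mem_d5_iff
  proof (intro iffI conjI; (elim conjE exE)?)
    fix C D
    assume C: "\<forall>n. (\<Sum>k<n. \<bar>abar lam a n k\<bar> powr q) \<le> C" and D: "\<forall>n. \<bar>abar lam a n n\<bar> \<le> D"
    have "(\<Sum>k\<le>n. \<bar>abar lam a n k\<bar> powr q) \<le> C + D powr q" for n
      unfolding split using C D assms by (intro add_mono powr_mono2) auto
    then show "\<exists>C. \<forall>n. (\<Sum>k\<le>n. \<bar>abar lam a n k\<bar> powr q) \<le> C" by blast
  next
    fix C
    assume C: "\<forall>n. (\<Sum>k\<le>n. \<bar>abar lam a n k\<bar> powr q) \<le> C"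
    have "(\<Sum>k<n. \<bar>abar lam a n k\<bar> powr q) \<le> C" for n
      using C[rule_format, of n] unfolding split by (smt (verit) powr_ge_zero)
    then show "\<exists>C. \<forall>n. (\<Sum>k<n. \<bar>abar lam a n k\<bar> powr q) \<le> C" by blast
    have "\<bar>abar lam a n n\<bar> \<le> C powr (1 / q)" for n
    proof -
      have "0 \<le> (\<Sum>k<n. \<bar>abar lam a n k\<bar> powr q)" by (intro sum_nonneg) auto
      then have "\<bar>abar lam a n n\<bar> powr q \<le> C"
        using C[rule_format, of n] unfolding split by linarith
      then have "(\<bar>abar lam a n n\<bar> powr q) powr (1 / q) \<le> C powr (1 / q)"
        using assms by (intro powr_mono2) auto
      then show ?thesis using assms by (simp add: powr_powr)
    qed
    then show "\<exists>C. \<forall>n. \<bar>abar lam a n n\<bar> \<le> C" by blast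
  qed
qed

lemma d8_subset_d4: "d8 lam \<subseteq> d4 lam 1"
proof
  fix a assume "a \<in> d8 lam"
  then have "\<exists>C. \<forall>n. (\<Sum>k\<le>n. \<bar>abar lam a n k\<bar> powr 1) \<le> C" by (simp add: mem_d8_iff)
  then show "a \<in> d4 lam 1" using mem_d4_d5_iff[of 1 a] by simp
qed

text \<open>The row bound of \<open>d8\<close> makes the limit row summable. Each series in
  \<open>d7\<close> then has a finite real value, so convergence to 0 in the extended half-line is
  convergence of reals.\<close>

lemma mem_d7_iff:
  assumes "a \<in> d8 lam"
  shows "a \<in> d7 lam \<longleftrightarrow> (\<forall>k. convergent (\<lambda>n. abar lam a n k)) \<and>
    (\<lambda>n. \<Sum>k. \<bar>abar lam a n k - lim (\<lambda>n. abar lam a n k)\<bar>) \<longlonglongrightarrow> 0"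
proof (cases "\<forall>k. convergent (\<lambda>n. abar lam a n k)")
  case True
  obtain C where C: "\<And>n. (\<Sum>k\<le>n. \<bar>abar lam a n k\<bar>) \<le> C"
    using assms by (auto simp: mem_d8_iff)
  have "(\<lambda>n. abar lam a n k) \<longlonglongrightarrow> abar_lim lam a k" for k
    using True by (simp add: abar_lim_def convergent_LIMSEQ_iff)
  then have lim: "summable (\<lambda>k. \<bar>abar_lim lam a k\<bar>)"
    using C by (rule tri_limit_summable)
  have row: "summable (\<lambda>k. \<bar>abar lam a n k - abar_lim lam a k\<bar>)" for n
    by (rule tri_row_diff_summable[OF abar_triangular lim])
  have "(\<Sum>k. ennreal \<bar>abar lam a n k - abar_lim lam a k\<bar>)
      = ennreal (\<Sum>k. \<bar>abar lam a n k - abar_lim lam a k\<bar>)" for n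
    by (rule suminf_ennreal2[OF _ row]) simp
  moreover have "0 \<le> (\<Sum>k. \<bar>abar lam a n k - abar_lim lam a k\<bar>)" for n
    by (rule suminf_nonneg[OF row]) simp
  ultimately show ?thesis
    using True unfolding d7_def ennreal_0[symmetric]
    by (simp add: tendsto_ennreal_iff abar_lim_def del: ennreal_0)
next
  case False
  then show ?thesis unfolding d7_def by blast
qed

section \<open>The three duals\<close>

lemma beta_dual_ell_p:
  assumes "filterlim lam at_top sequentially" "1 < p" "p < \<infinity>"
  shows "beta_dual (ell_lam_F lam p) = d3 \<inter> d4 lam (conj_exp p) \<inter> d5 lam"
proof -
  obtain r where r: "p = ereal r" "1 < r"
    using assms(2,3) by (cases p) auto
  have q: "conj_exp p = r / (r - 1)" "0 < conj_exp p"
    using r by (simp_all add: conj_exp_def)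
  show ?thesis
  proof (rule set_eqI)
    fix a
    show "a \<in> beta_dual (ell_lam_F lam p) \<longleftrightarrow> a \<in> d3 \<inter> d4 lam (conj_exp p) \<inter> d5 lam"
      using mem_d4_d5_iff[OF q(2), of a] columns_convergent_iff_d3[OF assms(1), of a]
        tri_into_c_ell_p_iff[where A = "abar lam a", OF abar_triangular r(2) q(1)]
      by (auto simp: beta_dual_iff r(1))
  qed
qed

lemma beta_dual_ell_1:
  assumes "filterlim lam at_top sequentially"
  shows "beta_dual (ell_lam_F lam 1) = d3 \<inter> d5 lam \<inter> d6 lam"
proof (rule set_eqI)
  fix a
  have "a \<in> d6 lam \<Longrightarrow> a \<in> d5 lam" unfolding mem_d5_iff mem_d6_iff by blast
  then show "a \<in> beta_dual (ell_lam_F lam 1) \<longleftrightarrow> a \<in> d3 \<inter> d5 lam \<inter> d6 lam"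
    using tri_into_c_ell_1_iff[where A = "abar lam a", OF abar_triangular]
      columns_convergent_iff_d3[OF assms, of a]
    by (auto simp: beta_dual_iff mem_d6_iff)
qed

lemma beta_dual_ell_infinity:
  "beta_dual (ell_lam_F lam \<infinity>) = d4 lam (conj_exp \<infinity>) \<inter> d7 lam \<inter> d8 lam"
proof (rule set_eqI)
  fix a
  have "a \<in> beta_dual (ell_lam_F lam \<infinity>) \<longleftrightarrow> a \<in> d7 lam \<and> a \<in> d8 lam"
    using tri_into_c_ell_infinity_iff[where A = "abar lam a", OF abar_triangular]
      mem_d7_iff[of a]
    by (auto simp: beta_dual_iff mem_d8_iff[symmetric])
  then show "a \<in> beta_dual (ell_lam_F lam \<infinity>) \<longleftrightarrow>
      a \<in> d4 lam (conj_exp \<infinity>) \<inter> d7 lam \<inter> d8 lam"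
    using d8_subset_d4 by (auto simp: conj_exp_def)
qed

end

theorem theorem3p5:
  fixes lam :: "nat \<Rightarrow> real"
  assumes "strict_mono lam"
    and "\<And>k. 0 < lam k"
    and "filterlim lam at_top sequentially"
  shows "(\<forall>p. 1 < p \<and> p < \<infinity> \<longrightarrow>
            beta_dual (ell_lam_F lam p) = d3 \<inter> d4 lam (conj_exp p) \<inter> d5 lam)
       \<and> beta_dual (ell_lam_F lam 1) = d3 \<inter> d5 lam \<inter> d6 lam
       \<and> beta_dual (ell_lam_F lam \<infinity>) = d4 lam (conj_exp \<infinity>) \<inter> d7 lam \<inter> d8 lam"
proof -
  interpret lambda_sequence lam by unfold_locales (fact assms)+
  show ?thesis
    using beta_dual_ell_p[OF assms(3)] beta_dual_ell_1[OF assms(3)] beta_dual_ell_infinity by blast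
qed

end
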